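(* Let $\theta=(N,p,c,\alpha,\beta)\in\Theta$ be a transport choice situation with TC game $(N,v^\theta)$ and market share exchange allocation $MSE$, where $MSE_i\neq 0$ for all $i\in N$. Let $\delta\in(0,1)$ satisfy $\delta\le 1-\frac{\sum_{i\in N}v^\theta(\{i\})}{v^\theta(N)}$ (with $v^\theta(N)\ne 0$), and let $(N,v^{\theta,\delta})$ be the associated TC-$\delta$ game. If $$\delta\le 1-\max_{i\in N}\frac{v^{\theta}(\{i\})}{MSE_i},$$ then $(1-\delta)\,MSE\in\mathscr{C}(N,v^{\theta,\delta})$; in particular $\mathscr{C}(N,v^{\theta,\delta})\neq\emptyset$.
   Context: A transport choice situation is a tuple $\theta=(N,p,c,\alpha,\beta)$ with $N\subseteq\mathbb{N}$ a finite nonempty set (of transport operators), $p=(p_i)_{i\in N}$ (prices), $c=(c_i)_{i\in N}$ (cost prices) and $\alpha=(\alpha_i)_{i\in N}$ (alternative-specific constants) vectors with nonnegative real entries, and $\beta>0$ a real number (price sensitivity). $\Theta$ is the set of all transport choice situations. For $M\subseteq N$ and real vectors $x$ (indexed by $N$ or by $M$) let $D^M(x)=\sum_{i\in M}e^{\alpha_i-\beta x_i}$. The transport choice (TC) game $(N,v^{\theta})$ associated with $\theta$ is the function $v^\theta:2^N\to\mathbb{R}$ with $v^\theta(\emptyset)=0$ and, for nonempty $M\subseteq N$, $$v^{\theta}(M)=\max_{x\in\mathbb{R}^M}\ \sum_{i\in M}(x_i-c_i)\frac{e^{\alpha_i-\beta x_i}}{1+\sum_{j\in M}e^{\alpha_j-\beta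 x_j}+\sum_{j\in N\setminus M}e^{\alpha_j-\beta p_j}}$$ subject to $$\sum_{i\in M}\frac{e^{\alpha_i-\beta p_i}}{1+\sum_{j\in N}e^{\alpha_j-\beta p_j}}=\sum_{i\in M}\frac{e^{\alpha_i-\beta x_i}}{1+\sum_{j\in M}e^{\alpha_j-\beta x_j}+\sum_{j\in N\setminus M}e^{\alpha_j-\beta p_j}}.$$ For $\delta\in(0,1)$, the TC-$\delta$ game $(N,v^{\theta,\delta})$ is defined by $v^{\theta,\delta}(M)=(1-\delta)\,v^\theta(M)$ if $|M|\ge 2$ and $v^{\theta,\delta}(M)=v^\theta(M)$ if $|M|\le 1$. The core is $$\mathscr{C}(N,v)=\Big\{x\in\mathbb{R}^N : \sum_{i\in M}x_i\ge v(M)\text{ for all }M\subseteq N,\ \sum_{i\in N}x_i=v(N)\Big\}.$$ Let $p^*\in\mathbb{R}^N$ be the price vector $p_i^*=c_i+\frac1\beta\ln\left(\frac{D^N(c)}{D^N(p)}\right)$, $i\in N$. The market share exchange (MSE) allocation rule is, for $i\in N$, $$MSE_i=(p_i^*-c_i)\frac{D^{\{i\}}(p^* )}{D^N(p^* )+1}-\phi\left(\frac{D^{\{i\}}(p^* )}{D^N(p^* )+1}-\frac{D^{\{i\}}(p)}{D^N(p)+1}\right),$$ where $$\phi=\frac{v^{\theta}(N)-v^{\widehat\theta}(N)}{D^N(p)/(D^N(p)+1)},\qquad \widehat\theta=(N,p,(p_i-1/\beta)_{i\in N},\alpha,\beta),$$ and $v^{\widehat\theta}(N)$ is given by the same definition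 as $v^\theta(N)$ with $c_i$ replaced by $p_i-1/\beta$ (these cost entries are allowed to be negative). *)

theory Defs
  imports Complex_Main "HOL-Library.FuncSet"
begin

text \<open>
  Vectors in \<open>\<real>\<^sup>M\<close> that are optimised over or that are allocations are functions in
  \<open>M \<rightarrow>\<^sub>E UNIV\<close>. The parameter vectors of a situation are functions on \<^typ>\<open>nat\<close> of
  which only the values on the set of operators matter.
\<close>

record situation =
  operators :: "nat set"
  price :: "nat \<Rightarrow> real"
  cost :: "nat \<Rightarrow> real"
  asc :: "nat \<Rightarrow> real"
  sens :: real

definition situations :: "situation set" where
  "situations = {\<theta>. finite (operators \<theta>) \<and> operators \<theta> \<noteq> {}
     \<and> price \<theta> \<in> operators \<theta> \<rightarrow> {0..}
     \<and> cost \<theta> \<in> operators \<theta> \<rightarrow> {0..}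
     \<and> asc \<theta> \<in> operators \<theta> \<rightarrow> {0..}
     \<and> sens \<theta> > 0}"

definition demand :: "situation \<Rightarrow> nat set \<Rightarrow> (nat \<Rightarrow> real) \<Rightarrow> real" where
  "demand \<theta> M x = (\<Sum>i\<in>M. exp (asc \<theta> i - sens \<theta> * x i))"

text \<open>Share of \<open>i\<close> when the coalition \<open>M\<close> charges \<open>x\<close> and all other operators keep their prices.\<close>

definition market_share :: "situation \<Rightarrow> nat set \<Rightarrow> (nat \<Rightarrow> real) \<Rightarrow> nat \<Rightarrow> real" where
  "market_share \<theta> M x i =
     exp (asc \<theta> i - sens \<theta> * x i)
       / (1 + demand \<theta> M x + demand \<theta> (operators \<theta> - M) (price \<theta>))"

definition feasible_prices :: "situation \<Rightarrow> nat set \<Rightarrow> (nat \<Rightarrow> real) set" where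
  "feasible_prices \<theta> M = {x \<in> M \<rightarrow>\<^sub>E UNIV.
     (\<Sum>i\<in>M. exp (asc \<theta> i - sens \<theta> * price \<theta> i) / (1 + demand \<theta> (operators \<theta>) (price \<theta>)))
       = (\<Sum>i\<in>M. market_share \<theta> M x i)}"

definition coalition_profit :: "situation \<Rightarrow> nat set \<Rightarrow> (nat \<Rightarrow> real) \<Rightarrow> real" where
  "coalition_profit \<theta> M x = (\<Sum>i\<in>M. (x i - cost \<theta> i) * market_share \<theta> M x i)"

text \<open>
  \<^const>\<open>Greatest\<close> expresses a maximum that is attained, as opposed to a supremum. The game is
  defined for every record, not only for members of \<^const>\<open>situations\<close>, because it is also
  evaluated at a situation whose cost prices may be negative.
\<close>

definition tc_game :: "situation \<Rightarrow> nat set \<Rightarrow> real" where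
  "tc_game \<theta> M =
     (if M = {} then 0 else (GREATEST r. r \<in> coalition_profit \<theta> M ` feasible_prices \<theta> M))"

definition tc_delta_game :: "situation \<Rightarrow> real \<Rightarrow> nat set \<Rightarrow> real" where
  "tc_delta_game \<theta> \<delta> M = (if card M \<ge> 2 then (1 - \<delta>) * tc_game \<theta> M else tc_game \<theta> M)"

definition core :: "nat set \<Rightarrow> (nat set \<Rightarrow> real) \<Rightarrow> (nat \<Rightarrow> real) set" where
  "core N v = {x \<in> N \<rightarrow>\<^sub>E UNIV. (\<forall>M\<subseteq>N. (\<Sum>i\<in>M. x i) \<ge> v M) \<and> (\<Sum>i\<in>N. x i) = v N}"

definition opt_price :: "situation \<Rightarrow> nat \<Rightarrow> real" where
  "opt_price \<theta> = (\<lambda>i\<in>operators \<theta>. cost \<theta> i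
     + 1 / sens \<theta> * ln (demand \<theta> (operators \<theta>) (cost \<theta>) / demand \<theta> (operators \<theta>) (price \<theta>)))"

definition hat_situation :: "situation \<Rightarrow> situation" where
  "hat_situation \<theta> = \<theta>\<lparr>cost := (\<lambda>i. price \<theta> i - 1 / sens \<theta>)\<rparr>"

definition exchange_price :: "situation \<Rightarrow> real" where
  "exchange_price \<theta> =
     (tc_game \<theta> (operators \<theta>) - tc_game (hat_situation \<theta>) (operators \<theta>))
       / (demand \<theta> (operators \<theta>) (price \<theta>) / (demand \<theta> (operators \<theta>) (price \<theta>) + 1))"

definition MSE :: "situation \<Rightarrow> nat \<Rightarrow> real" where
  "MSE \<theta> = (\<lambda>i\<in>operators \<theta>.
     (opt_price \<theta> i - cost \<theta> i)
         * (demand \<theta> {i} (opt_price \<theta>) / (demand \<theta> (operators \<theta>) (opt_price \<theta>) + 1))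
       - exchange_price \<theta>
         * (demand \<theta> {i} (opt_price \<theta>) / (demand \<theta> (operators \<theta>) (opt_price \<theta>) + 1)
            - demand \<theta> {i} (price \<theta>) / (demand \<theta> (operators \<theta>) (price \<theta>) + 1)))"

end

theory Submission
  imports Defs
begin

text \<open>
  Write \<open>P\<^sub>M\<close> and \<open>C\<^sub>M\<close> for the demand of a coalition \<open>M\<close> at the prices and at the cost prices,
  \<open>\<beta>\<close> for the price sensitivity, and \<open>f (q, d) = q * ln (d / q)\<close>. A coalition
  that has to keep its market share has to keep its total demand, so it only redistributes \<open>P\<^sub>M\<close> among its members. If it assigns demand \<open>y\<^sub>i\<close> to \<open>i\<close>,
  the margin of \<open>i\<close> is \<open>ln (C\<^sub>i / y\<^sub>i) / \<beta>\<close>, so that its profit is \<open>(\<Sum>i\<in>M. f (y\<^sub>i, C\<^sub>i))\<close> up to the factor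
  \<open>1 / (\<beta> * (1 + P\<^sub>N))\<close>. By the log sum inequality the best redistribution takes \<open>y\<^sub>i\<close>
  proportional to \<open>C\<^sub>i\<close>, and \<open>M\<close> is worth \<open>f (P\<^sub>M, C\<^sub>M)\<close> up to the same factor
  (\<open>tc_game_eq\<close>).

  The function \<open>f\<close> is concave and homogeneous of degree one. Hence the TC game is a market game in
  which player \<open>i\<close> owns the goods \<open>(P\<^sub>i, C\<^sub>i)\<close>, and paying everybody for these goods at the
  gradient of \<open>f\<close> at \<open>(P\<^sub>N, C\<^sub>N)\<close> distributes \<open>f (P\<^sub>N, C\<^sub>N)\<close> exactly, by homogeneity, and
  covers \<open>f (P\<^sub>M, C\<^sub>M)\<close>, because a concave function lies below its tangents. The allocation \<open>MSE\<close> is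
  this competitive payment (\<open>MSE_eq\<close>), so it is in the core of the TC game.

  Scaling by \<open>1 - \<delta>\<close> preserves all core conditions for coalitions with at least two members. For a
  single player, the bound on \<open>\<delta>\<close> reads \<open>v {i} / MSE i \<le> 1 - \<delta> < 1\<close>. Since \<open>v {i} \<le> MSE i\<close>, a negative
  \<open>MSE i\<close> would make this quotient at least one; so \<open>MSE i\<close> is positive and the bound becomes
  \<open>v {i} \<le> (1 - \<delta>) * MSE i\<close>. A lone operator would have \<open>v {i} / MSE i = 1\<close>, so the same bound
  ensures that the grand coalition has at least two members and that its value is scaled too.
\<close>

section \<open>The log sum inequality\<close>

text \<open>
  The right-hand side is the tangent of \<open>q * ln (d / q)\<close> along the ray \<open>d / q = r\<close>. The log sum
  inequality adds up instances with a common \<open>r\<close>; a core condition is the instance for the total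
  demands of the coalition, with the ratio \<open>r\<close> of the whole market.
\<close>

lemma mult_ln_divide_le_tangent:
  fixes q d r :: real
  assumes "q > 0" "d > 0" "r > 0"
  shows "q * ln (d / q) \<le> q * (ln r - 1) + d / r"
proof -
  have "ln (d / (q * r)) \<le> d / (q * r) - 1"
    using assms by (intro ln_le_minus_one) simp
  also have "ln (d / (q * r)) = ln (d / q) - ln r"
    using assms by (simp add: ln_div ln_mult)
  finally have "q * ln (d / q) \<le> q * (ln r - 1 + d / (q * r))"
    using assms by (intro mult_left_mono) auto
  also have "\<dots> = q * (ln r - 1) + d / r"
    using assms by (simp add: field_simps)
  finally show ?thesis .
qed

lemma log_sum_inequality:
  fixes y d :: "'a \<Rightarrow> real"
  assumes "finite M" "M \<noteq> {}" "\<And>i. i \<in> M \<Longrightarrow> y i > 0" "\<And>i. i \<in> M \<Longrightarrow> d i > 0"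
  shows "(\<Sum>i\<in>M. y i * ln (d i / y i)) \<le> sum y M * ln (sum d M / sum y M)"
proof -
  define r where "r = sum d M / sum y M"
  have pos: "sum y M > 0" "sum d M > 0"
    using assms by (auto intro: sum_pos)
  then have "r > 0"
    by (simp add: r_def)
  then have "(\<Sum>i\<in>M. y i * ln (d i / y i)) \<le> (\<Sum>i\<in>M. y i * (ln r - 1) + d i / r)"
    using assms by (intro sum_mono mult_ln_divide_le_tangent) auto
  also have "\<dots> = sum y M * (ln r - 1) + sum d M / r"
    by (simp add: sum.distrib flip: sum_distrib_right sum_divide_distrib)
  also have "\<dots> = sum y M * ln r"
    using pos by (simp add: r_def algebra_simps)
  finally show ?thesis
    by (simp add: r_def)
qed

section \<open>The value of a coalition\<close>

lemma demand_pos: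
  assumes "finite M" "M \<noteq> {}"
  shows "demand \<theta> M x > 0"
  unfolding demand_def using assms by (intro sum_pos) auto

lemma demand_nonneg: "demand \<theta> M x \<ge> 0"
  unfolding demand_def by (intro sum_nonneg) simp

lemma demand_split:
  assumes "finite (operators \<theta>)" "M \<subseteq> operators \<theta>"
  shows "demand \<theta> (operators \<theta>) x = demand \<theta> M x + demand \<theta> (operators \<theta> - M) x"
  unfolding demand_def using sum.subset_diff[OF assms(2,1)] by (simp add: add.commute)

lemma demand_eq_sum_singletons: "demand \<theta> M x = (\<Sum>i\<in>M. demand \<theta> {i} x)"
  by (simp add: demand_def)

lemma demand_singleton_markup:
  assumes "sens \<theta> > 0" "r > 0" "x i = y i + ln r / sens \<theta>"
  shows "demand \<theta> {i} x = demand \<theta> {i} y / r"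
  using assms by (simp add: demand_def distrib_left exp_diff exp_add)

text \<open>
  For a fixed outside demand \<open>k\<close>, the share \<open>t / (k + t)\<close> determines \<open>t\<close>; so keeping the market share
  means keeping the demand.
\<close>

lemma mem_feasible_prices_iff:
  assumes "finite (operators \<theta>)" "M \<subseteq> operators \<theta>"
  shows "x \<in> feasible_prices \<theta> M
    \<longleftrightarrow> x \<in> M \<rightarrow>\<^sub>E UNIV \<and> demand \<theta> M x = demand \<theta> M (price \<theta>)"
proof -
  define k where "k = 1 + demand \<theta> (operators \<theta> - M) (price \<theta>)"
  have "k > 0"
    using demand_nonneg[of \<theta> "operators \<theta> - M" "price \<theta>"] by (simp add: k_def)
  then have cancel: "s / (k + s) = t / (k + t) \<longleftrightarrow> t = s" if "s \<ge> 0" "t \<ge> 0" for s t :: real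
    using that by (auto simp: frac_eq_eq add_pos_nonneg algebra_simps)
  have "(\<Sum>i\<in>M. exp (asc \<theta> i - sens \<theta> * price \<theta> i) / (1 + demand \<theta> (operators \<theta>) (price \<theta>)))
      = demand \<theta> M (price \<theta>) / (k + demand \<theta> M (price \<theta>))"
    using demand_split[OF assms, of "price \<theta>"]
    by (simp add: demand_def k_def add_ac flip: sum_divide_distrib)
  moreover have "(\<Sum>i\<in>M. market_share \<theta> M x i) = demand \<theta> M x / (k + demand \<theta> M x)"
    by (simp add: market_share_def demand_def k_def add_ac flip: sum_divide_distrib)
  ultimately show ?thesis
    using cancel[OF demand_nonneg demand_nonneg, of \<theta> M "price \<theta>" \<theta> M x]
    by (simp add: feasible_prices_def)
qed

text \<open>
  The margin is the logarithm of the ratio of the demands at cost and at the chosen price, which turns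
  the profit into the expression of the log sum inequality.
\<close>

lemma coalition_profit_eq:
  assumes "finite (operators \<theta>)" "M \<subseteq> operators \<theta>" "sens \<theta> > 0" "x \<in> feasible_prices \<theta> M"
  shows "coalition_profit \<theta> M x =
    (\<Sum>i\<in>M. demand \<theta> {i} x * ln (demand \<theta> {i} (cost \<theta>) / demand \<theta> {i} x))
      / (sens \<theta> * (1 + demand \<theta> (operators \<theta>) (price \<theta>)))"
proof -
  have "demand \<theta> M x = demand \<theta> M (price \<theta>)"
    using assms by (simp add: mem_feasible_prices_iff)
  then have "market_share \<theta> M x i = demand \<theta> {i} x / (1 + demand \<theta> (operators \<theta>) (price \<theta>))" for i
    using demand_split[OF assms(1,2), of "price \<theta>"]
    by (simp add: market_share_def demand_def add.assoc)
  moreover have "x i - cost \<theta> i = ln (demand \<theta> {i} (cost \<theta>) / demand \<theta> {i} x) / sens \<theta>" for i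
    using assms(3) by (simp add: demand_def ln_div field_simps)
  ultimately show ?thesis
    unfolding coalition_profit_def by (simp add: sum_divide_distrib mult_ac)
qed

lemma tc_game_eq:
  assumes fin: "finite (operators \<theta>)" and sub: "M \<subseteq> operators \<theta>" and ne: "M \<noteq> {}"
    and sens: "sens \<theta> > 0"
  shows "tc_game \<theta> M =
    demand \<theta> M (price \<theta>) * ln (demand \<theta> M (cost \<theta>) / demand \<theta> M (price \<theta>))
      / (sens \<theta> * (1 + demand \<theta> (operators \<theta>) (price \<theta>)))"
    (is "_ = ?v")
proof -
  define K where "K = sens \<theta> * (1 + demand \<theta> (operators \<theta>) (price \<theta>))"
  define r where "r = demand \<theta> M (cost \<theta>) / demand \<theta> M (price \<theta>)"
  have finM: "finite M"
    using fin sub by (rule rev_finite_subset)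
  have pos: "demand \<theta> M x > 0" for x
    by (rule demand_pos[OF finM ne])
  have "r > 0"
    by (simp add: r_def pos)
  have "K > 0"
    using sens demand_nonneg[of \<theta> "operators \<theta>" "price \<theta>"] by (simp add: K_def)
  \<comment> \<open>Equality in the log sum inequality needs a constant ratio of the demands, i.e. a common margin;
    its value is dictated by the demand that has to be kept.\<close>
  define x where "x = (\<lambda>i\<in>M. cost \<theta> i + ln r / sens \<theta>)"
  have single: "demand \<theta> {i} x = demand \<theta> {i} (cost \<theta>) / r" if "i \<in> M" for i
    using that by (intro demand_singleton_markup[OF sens \<open>r > 0\<close>]) (simp add: x_def)
  have demand_x: "demand \<theta> M x = demand \<theta> M (price \<theta>)"
  proof -
    have "demand \<theta> M x = demand \<theta> M (cost \<theta>) / r"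
      by (subst (1 2) demand_eq_sum_singletons) (simp add: single sum_divide_distrib)
    then show ?thesis
      using pos[of "cost \<theta>"] by (simp add: r_def)
  qed
  then have feas: "x \<in> feasible_prices \<theta> M"
    by (simp add: mem_feasible_prices_iff[OF fin sub] x_def)
  have "coalition_profit \<theta> M x = (\<Sum>i\<in>M. demand \<theta> {i} x * ln r) / K"
    using \<open>r > 0\<close> unfolding coalition_profit_eq[OF fin sub sens feas] K_def
    by (intro arg_cong2[where f = "(/)"] sum.cong)
      (auto simp: single demand_pos[THEN less_imp_neq, symmetric])
  also have "\<dots> = ?v"
    using demand_x by (simp add: K_def r_def flip: sum_distrib_right demand_eq_sum_singletons)
  finally have attained: "coalition_profit \<theta> M x = ?v" .
  have bound: "coalition_profit \<theta> M z \<le> ?v" if z: "z \<in> feasible_prices \<theta> M" for z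
  proof -
    have "(\<Sum>i\<in>M. demand \<theta> {i} z * ln (demand \<theta> {i} (cost \<theta>) / demand \<theta> {i} z))
        \<le> demand \<theta> M z * ln (demand \<theta> M (cost \<theta>) / demand \<theta> M z)"
      using log_sum_inequality[OF finM ne, of "\<lambda>i. demand \<theta> {i} z" "\<lambda>i. demand \<theta> {i} (cost \<theta>)"]
      by (simp add: demand_pos flip: demand_eq_sum_singletons)
    moreover have "demand \<theta> M z = demand \<theta> M (price \<theta>)"
      using z by (simp add: mem_feasible_prices_iff[OF fin sub])
    ultimately show ?thesis
      using \<open>K > 0\<close>
      by (simp add: coalition_profit_eq[OF fin sub sens z] divide_right_mono flip: K_def)
  qed
  have "(GREATEST t. t \<in> coalition_profit \<theta> M ` feasible_prices \<theta> M) = ?v"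
  proof (rule Greatest_equality)
    show "?v \<in> coalition_profit \<theta> M ` feasible_prices \<theta> M"
      using attained feas by (metis imageI)
  qed (use bound in auto)
  then show ?thesis
    using ne by (simp add: tc_game_def)
qed

section \<open>Market share exchange as a competitive payment\<close>

text \<open>
  With cost prices \<open>p\<^sub>i - 1 / \<beta>\<close> every margin at the given prices is \<open>1 / \<beta>\<close>, the demand ratio is
  \<open>exp 1\<close>, and the grand coalition cannot improve on \<open>p\<close>. Subtracting this value turns the exchange
  price into the derivative of \<open>q * ln (d / q)\<close> with respect to \<open>q\<close>, divided by \<open>\<beta>\<close>.
\<close>

lemma exchange_price_eq:
  assumes "finite (operators \<theta>)" "operators \<theta> \<noteq> {}" "sens \<theta> > 0"
  shows "exchange_price \<theta> =
    (ln (demand \<theta> (operators \<theta>) (cost \<theta>) / demand \<theta> (operators \<theta>) (price \<theta>)) - 1) / sens \<theta>"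
proof -
  let ?N = "operators \<theta>" and ?h = "hat_situation \<theta>"
  have P: "demand \<theta> ?N (price \<theta>) > 0"
    using assms by (intro demand_pos)
  have hat: "demand ?h M x = demand \<theta> M x" "operators ?h = ?N" "sens ?h = sens \<theta>"
    "price ?h = price \<theta>" for M x
    by (simp_all add: demand_def hat_situation_def)
  have "demand \<theta> ?N (cost ?h) = exp 1 * demand \<theta> ?N (price \<theta>)"
    using assms(3)
    by (simp add: demand_def hat_situation_def right_diff_distrib exp_diff sum_distrib_left mult_ac)
  then have "tc_game ?h ?N = demand \<theta> ?N (price \<theta>) / (sens \<theta> * (1 + demand \<theta> ?N (price \<theta>)))"
    using assms P by (subst tc_game_eq) (simp_all add: hat)
  moreover have "(a * L / (b * (1 + a)) - a / (b * (1 + a))) / (a / (a + 1)) = (L - 1) / b"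
    if "a > 0" "b > 0" for a b L :: real
  proof -
    have "a * L / (b * (1 + a)) - a / (b * (1 + a)) = (L - 1) / b * (a / (a + 1))"
      using that by (simp add: algebra_simps flip: diff_divide_distrib)
    then show ?thesis
      using that by simp
  qed
  ultimately show ?thesis
    using P assms unfolding exchange_price_def
    by (simp add: tc_game_eq[OF assms(1) subset_refl assms(2,3)])
qed

text \<open>
  The gradient of \<open>q * ln (d / q)\<close> at the total demands is \<open>(ln r - 1, 1 / r)\<close>, so up to the factor in
  the denominator this is the payment for the goods \<open>(P\<^sub>i, C\<^sub>i)\<close>. It arises because player \<open>i\<close> earns
  \<open>ln r / \<beta>\<close> on its demand \<open>C\<^sub>i / r\<close> at the optimal prices and buys the increase from \<open>P\<^sub>i\<close> to \<open>C\<^sub>i / r\<close> at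
  \<open>(ln r - 1) / \<beta>\<close> per unit.
\<close>

lemma MSE_eq:
  assumes fin: "finite (operators \<theta>)" and sens: "sens \<theta> > 0" and i: "i \<in> operators \<theta>"
  defines "r \<equiv> demand \<theta> (operators \<theta>) (cost \<theta>) / demand \<theta> (operators \<theta>) (price \<theta>)"
  shows "MSE \<theta> i =
    (demand \<theta> {i} (price \<theta>) * (ln r - 1) + demand \<theta> {i} (cost \<theta>) / r)
      / (sens \<theta> * (1 + demand \<theta> (operators \<theta>) (price \<theta>)))"
proof -
  let ?N = "operators \<theta>"
  have ne: "?N \<noteq> {}"
    using i by auto
  have P: "demand \<theta> ?N (price \<theta>) > 0" and C: "demand \<theta> ?N (cost \<theta>) > 0"
    using fin ne by (auto intro: demand_pos)
  then have r: "r > 0"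
    by (simp add: r_def)
  have opt: "opt_price \<theta> j = cost \<theta> j + ln r / sens \<theta>" if "j \<in> ?N" for j
    using that by (simp add: opt_price_def r_def)
  have single: "demand \<theta> {j} (opt_price \<theta>) = demand \<theta> {j} (cost \<theta>) / r" if "j \<in> ?N" for j
    using opt[OF that] by (rule demand_singleton_markup[OF sens r])
  have "demand \<theta> ?N (opt_price \<theta>) = demand \<theta> ?N (cost \<theta>) / r"
    by (subst (1 2) demand_eq_sum_singletons) (simp add: single sum_divide_distrib)
  then have total: "demand \<theta> ?N (opt_price \<theta>) = demand \<theta> ?N (price \<theta>)"
    using C by (simp add: r_def)
  have "MSE \<theta> i = ln r / sens \<theta> * (demand \<theta> {i} (cost \<theta>) / r / (demand \<theta> ?N (price \<theta>) + 1))
     - (ln r - 1) / sens \<theta> * (demand \<theta> {i} (cost \<theta>) / r / (demand \<theta> ?N (price \<theta>) + 1)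
         - demand \<theta> {i} (price \<theta>) / (demand \<theta> ?N (price \<theta>) + 1))"
    using i unfolding MSE_def exchange_price_eq[OF fin ne sens]
    by (simp add: total single opt flip: r_def)
  also have "\<dots> = (demand \<theta> {i} (price \<theta>) * (ln r - 1) + demand \<theta> {i} (cost \<theta>) / r)
      / (sens \<theta> * (1 + demand \<theta> ?N (price \<theta>)))"
  proof -
    have "L / b * (d / (a + 1)) - (L - 1) / b * (d / (a + 1) - q / (a + 1))
        = (q * (L - 1) + d) / (b * (1 + a))" if "a > 0" "b > 0" for a b d q L :: real
      using that by (simp add: divide_simps) algebra
    from this[OF P sens] show ?thesis .
  qed
  finally show ?thesis .
qed

theorem MSE_mem_core_tc_game:
  assumes "\<theta> \<in> situations"
  shows "MSE \<theta> \<in> core (operators \<theta>) (tc_game \<theta>)"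
proof -
  let ?N = "operators \<theta>"
  define r where "r = demand \<theta> ?N (cost \<theta>) / demand \<theta> ?N (price \<theta>)"
  define K where "K = sens \<theta> * (1 + demand \<theta> ?N (price \<theta>))"
  have fin: "finite ?N" and ne: "?N \<noteq> {}" and sens: "sens \<theta> > 0"
    using assms by (auto simp: situations_def)
  have P: "demand \<theta> ?N (price \<theta>) > 0" and C: "demand \<theta> ?N (cost \<theta>) > 0"
    using fin ne by (auto intro: demand_pos)
  have "r > 0" "K > 0"
    using P C sens by (auto simp: r_def K_def)
  have sum_MSE: "sum (MSE \<theta>) M =
      (demand \<theta> M (price \<theta>) * (ln r - 1) + demand \<theta> M (cost \<theta>) / r) / K"
    if "M \<subseteq> ?N" for M
  proof -
    have "sum (MSE \<theta>) M =
        (\<Sum>i\<in>M. (demand \<theta> {i} (price \<theta>) * (ln r - 1) + demand \<theta> {i} (cost \<theta>) / r) / K)"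
      using that unfolding r_def K_def by (intro sum.cong MSE_eq[OF fin sens]) auto
    then show ?thesis
      by (simp add: sum.distrib demand_eq_sum_singletons[of \<theta> M]
          flip: sum_divide_distrib sum_distrib_right)
  qed
  have "tc_game \<theta> M \<le> sum (MSE \<theta>) M" if "M \<subseteq> ?N" for M
  proof (cases "M = {}")
    case True
    then show ?thesis
      by (simp add: tc_game_def)
  next
    case False
    have "finite M"
      using fin that by (rule rev_finite_subset)
    then have "demand \<theta> M (price \<theta>) > 0" "demand \<theta> M (cost \<theta>) > 0"
      using False by (auto intro: demand_pos)
    from mult_ln_divide_le_tangent[OF this \<open>r > 0\<close>] show ?thesis
      using \<open>K > 0\<close>
      by (simp add: tc_game_eq[OF fin that False sens] sum_MSE[OF that] divide_right_mono flip: K_def)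
  qed
  moreover have "sum (MSE \<theta>) ?N = tc_game \<theta> ?N"
    using P C by (simp add: tc_game_eq[OF fin subset_refl ne sens] sum_MSE r_def K_def algebra_simps)
  ultimately show ?thesis
    by (auto simp: core_def MSE_def)
qed

section \<open>The core after a proportional loss\<close>

theorem theorem4:
  fixes \<theta> :: situation and \<delta> :: real
  assumes "\<theta> \<in> situations"
    and "\<forall>i\<in>operators \<theta>. MSE \<theta> i \<noteq> 0"
    and "0 < \<delta>" and "\<delta> < 1"
    and "tc_game \<theta> (operators \<theta>) \<noteq> 0"
    and "\<delta> \<le> 1 - (\<Sum>i\<in>operators \<theta>. tc_game \<theta> {i}) / tc_game \<theta> (operators \<theta>)"
    and "\<delta> \<le> 1 - Max ((\<lambda>i. tc_game \<theta> {i} / MSE \<theta> i) ` operators \<theta>)"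
  shows "(\<lambda>i\<in>operators \<theta>. (1 - \<delta>) * MSE \<theta> i) \<in> core (operators \<theta>) (tc_delta_game \<theta> \<delta>)
    \<and> core (operators \<theta>) (tc_delta_game \<theta> \<delta>) \<noteq> {}"
proof -
  let ?N = "operators \<theta>"
  let ?x = "\<lambda>i\<in>?N. (1 - \<delta>) * MSE \<theta> i"
  have fin: "finite ?N" and ne: "?N \<noteq> {}"
    using assms(1) by (auto simp: situations_def)
  have above: "tc_game \<theta> M \<le> sum (MSE \<theta>) M" if "M \<subseteq> ?N" for M
    using MSE_mem_core_tc_game[OF assms(1)] that by (auto simp: core_def)
  have efficient: "sum (MSE \<theta>) ?N = tc_game \<theta> ?N"
    using MSE_mem_core_tc_game[OF assms(1)] by (simp add: core_def)
  have ratio: "tc_game \<theta> {i} / MSE \<theta> i \<le> 1 - \<delta>" if "i \<in> ?N" for i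
  proof -
    have "tc_game \<theta> {i} / MSE \<theta> i \<le> Max ((\<lambda>i. tc_game \<theta> {i} / MSE \<theta> i) ` ?N)"
      using fin that by (intro Max_ge) auto
    with assms(7) show ?thesis
      by simp
  qed
  have single: "tc_game \<theta> {i} \<le> (1 - \<delta>) * MSE \<theta> i" if "i \<in> ?N" for i
  proof -
    have "MSE \<theta> i > 0"
    proof (rule ccontr)
      assume "\<not> MSE \<theta> i > 0"
      then have "MSE \<theta> i < 0"
        using assms(2) that by force
      then have "tc_game \<theta> {i} / MSE \<theta> i \<ge> 1"
        using above[of "{i}"] that by (simp add: le_divide_eq)
      then show False
        using ratio[OF that] assms(3) by simp
    qed
    then show ?thesis
      using ratio[OF that] by (simp add: divide_le_eq)
  qed
  have "card ?N \<noteq> 1"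
  proof
    assume "card ?N = 1"
    then obtain i where N: "?N = {i}"
      by (rule card_1_singletonE)
    then have "tc_game \<theta> {i} / MSE \<theta> i = 1"
      using efficient assms(2) by simp
    then show False
      using ratio[of i] N assms(3) by simp
  qed
  then have "card ?N \<ge> 2"
    using fin ne card_gt_0_iff[of ?N] by linarith
  have sum_x: "sum ?x M = (1 - \<delta>) * sum (MSE \<theta>) M" if "M \<subseteq> ?N" for M
    unfolding sum_distrib_left using that by (intro sum.cong) auto
  have "tc_delta_game \<theta> \<delta> M \<le> sum ?x M" if "M \<subseteq> ?N" for M
  proof -
    have "finite M"
      using fin that by (rule rev_finite_subset)
    consider "card M \<ge> 2" | "M = {}" | i where "M = {i}"
      using \<open>finite M\<close> by (metis One_nat_def card_1_singletonE card_eq_0_iff less_2_cases not_less)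
    then show ?thesis
    proof cases
      case 1
      then show ?thesis
        using above[OF that] assms(4) unfolding sum_x[OF that] by (simp add: tc_delta_game_def)
    next
      case 2
      then show ?thesis
        by (simp add: tc_delta_game_def tc_game_def)
    next
      case 3
      then show ?thesis
        using single that by (simp add: tc_delta_game_def)
    qed
  qed
  moreover have "sum ?x ?N = tc_delta_game \<theta> \<delta> ?N"
    using \<open>card ?N \<ge> 2\<close> by (simp only: sum_x[OF subset_refl] efficient tc_delta_game_def if_True)
  ultimately have "?x \<in> core ?N (tc_delta_game \<theta> \<delta>)"
    by (simp add: core_def)
  then show ?thesis
    by blast
qed

end
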